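(* Let $\mathbb{F}$ be a non-archimedean complete field of characteristic zero, $f=(f_1,\dots,f_n):\mathbb{F}^n\to\mathbb{F}^n$ a polynomial map and $x\in\mathbb{F}^n$. Then the following are equivalent: ($\alpha$) $\alpha(f,x)<1$; ($\gamma$) $\mathrm{dist}(x,f^{-1}(0))<1/\gamma(f,x)$. Moreover, if either condition holds, then the Newton sequence $\{N_f^k(x)\}_k$ is well-defined and converges quadratically to a non-singular zero $\zeta$ of $f$; more precisely, for all $k$: (a) $\alpha(f,N_f^k(x))\le\alpha(f,x)^{2^k}$; (b) $\beta(f,N_f^k(x))\le\beta(f,x)\alpha(f,x)^{2^k}$; (c) $\gamma(f,N_f^k(x))\le\gamma(f,x)$; (Q) $\|N_f^k(x)-\zeta\|=\beta(f,N_f^k(x))\le\alpha(f,x)^{2^k}\beta(f,x)<\alpha(f,x)^{2^k}/\gamma(f,x)$.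
   Context: $\mathbb{F}$ carries an ultrametric absolute value $|\cdot|$; on $\mathbb{F}^n$, $\|x\|:=\max_i|x_i|$ and $\mathrm{dist}(x,y)=\|x-y\|$; $\mathrm{dist}(x,f^{-1}(0))$ is the infimum of $\|x-z\|$ over zeros $z\in\mathbb{F}^n$ of $f$. A $k$-multilinear map $A:(\mathbb{F}^n)^k\to\mathbb{F}^q$ has norm $\|A\|:=\sup_{v_i\ne0}\|A(v_1,\dots,v_k)\|/(\|v_1\|\cdots\|v_k\|)$. If the derivative $D_xf$ is non-singular: $\beta(f,x):=\|D_xf^{-1}f(x)\|$, $\gamma(f,x):=\sup_{k\ge2}\|D_xf^{-1}D_x^kf/k!\|^{1/(k-1)}$, $\alpha(f,x):=\beta(f,x)\gamma(f,x)$; otherwise all three are $\infty$. Newton operator: $N_f(x):=x-D_xf^{-1}f(x)$. Conventions $1/\infty=0$, $1/0=\infty$.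
   Formalization: In (b) and (Q) the exponent 2^k is replaced by 2^k−1 (as printed, (b) fails at k=0 whenever β>0, and for X²+X+c at every k); the last strict inequality of (Q) is stated only when α(f,x)≠0 or k=0, since otherwise it reads 0<0 or involves 0/0. *)

theory Defs
  imports "HOL-Analysis.Analysis" "HOL-Library.Poly_Mapping"
begin

text \<open>
  The library constrains \<open>norm\<close> to real normed vector spaces, so the absolute value is a class
  parameter of its own. It induces the metric, hence positivity and definiteness follow from the
  metric axioms. The trivial absolute value is not excluded. Completeness is the separate sort
  \<open>complete_space\<close>.
\<close>

class ultrametric_field = field_char_0 + metric_space +
  fixes absval :: "'a \<Rightarrow> real"
  assumes dist_absval: "dist x y = absval (x - y)"
    and absval_mult: "absval (x * y) = absval x * absval y"
    and absval_ultrametric: "absval (x + y) \<le> max (absval x) (absval y)"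

text \<open>
  The maximum norm. The library's \<open>dist\<close> on \<open>'a ^ 'n\<close> is the Euclidean one, so it is not used.
\<close>

definition vnorm :: "'a::ultrametric_field ^ 'n \<Rightarrow> real" where
  "vnorm v = Max (range (\<lambda>i. absval (v $ i)))"

text \<open>
  A polynomial in the variables indexed by \<open>'n\<close> is a finitely supported map from exponent
  vectors to coefficients.
\<close>

type_synonym ('n, 'a) mpoly = "('n \<Rightarrow>\<^sub>0 nat) \<Rightarrow>\<^sub>0 'a"

definition mpoly_eval :: "('n::finite, 'a::comm_semiring_1) mpoly \<Rightarrow> 'a ^ 'n \<Rightarrow> 'a" where
  "mpoly_eval P x =
     (\<Sum>m\<in>Poly_Mapping.keys P.
        Poly_Mapping.lookup P m * (\<Prod>i\<in>UNIV. x $ i ^ Poly_Mapping.lookup m i))"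

text \<open>
  The exponent subtraction truncates at 0, but then the coefficient vanishes.
\<close>

definition mpoly_deriv :: "'n \<Rightarrow> ('n, 'a::comm_semiring_1) mpoly \<Rightarrow> ('n, 'a) mpoly" where
  "mpoly_deriv i P =
     (\<Sum>m\<in>Poly_Mapping.keys P.
        Poly_Mapping.single (m - Poly_Mapping.single i 1)
          (of_nat (Poly_Mapping.lookup m i) * Poly_Mapping.lookup P m))"

definition map_eval :: "('n::finite, 'a::comm_semiring_1) mpoly ^ 'q \<Rightarrow> 'a ^ 'n \<Rightarrow> 'a ^ 'q" where
  "map_eval f x = (\<chi> i. mpoly_eval (f $ i) x)"

definition jacobian_mat :: "('n::finite, 'a::comm_semiring_1) mpoly ^ 'q \<Rightarrow> 'a ^ 'n \<Rightarrow> 'a ^ 'n ^ 'q" where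
  "jacobian_mat f x = (\<chi> i j. mpoly_eval (mpoly_deriv j (f $ i)) x)"

text \<open>
  The \<open>k\<close>-th derivative as a \<open>k\<close>-multilinear map; the arguments form a list \<open>vs\<close> of length \<open>k\<close>,
  and \<open>js\<close> runs over all \<open>k\<close>-tuples of variable indices.
\<close>

definition higher_deriv ::
    "nat \<Rightarrow> ('n::finite, 'a::comm_semiring_1) mpoly ^ 'q \<Rightarrow> 'a ^ 'n \<Rightarrow> ('a ^ 'n) list \<Rightarrow> 'a ^ 'q" where
  "higher_deriv k f x vs =
     (\<chi> i. \<Sum>js\<in>{js :: 'n list. length js = k}.
        mpoly_eval (foldr mpoly_deriv js (f $ i)) x * (\<Prod>l<k. vs ! l $ (js ! l)))"

text \<open>
  The supremum is taken in the reals: the set is nonempty, and it is bounded for every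
  \<open>k\<close>-multilinear \<open>A\<close>, since \<open>vnorm (A vs)\<close> is at most the largest value of \<open>vnorm \<circ> A\<close> on
  tuples of standard basis vectors times the product of the norms.
\<close>

definition multilinear_norm ::
    "nat \<Rightarrow> (('a::ultrametric_field ^ 'n) list \<Rightarrow> 'a ^ 'q) \<Rightarrow> real" where
  "multilinear_norm k A =
     (SUP vs\<in>{vs. length vs = k \<and> 0 \<notin> set vs}. vnorm (A vs) / prod_list (map vnorm vs))"

text \<open>
  The quantities live in \<open>ennreal\<close>, where \<open>1 / 0 = \<infinity>\<close> and \<open>1 / \<infinity> = 0\<close>. In the singular case
  the product defining \<open>smale_alpha\<close> is \<open>\<infinity> * \<infinity> = \<infinity>\<close>.
\<close>

definition smale_beta ::
    "('n::finite, 'a::ultrametric_field) mpoly ^ 'n \<Rightarrow> 'a ^ 'n \<Rightarrow> ennreal" where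
  "smale_beta f x =
     (if invertible (jacobian_mat f x)
      then ennreal (vnorm (matrix_inv (jacobian_mat f x) *v map_eval f x))
      else \<infinity>)"

definition smale_gamma ::
    "('n::finite, 'a::ultrametric_field) mpoly ^ 'n \<Rightarrow> 'a ^ 'n \<Rightarrow> ennreal" where
  "smale_gamma f x =
     (if invertible (jacobian_mat f x)
      then SUP k\<in>{2..}. ennreal (root (k - 1)
             (multilinear_norm k
               (\<lambda>vs. matrix_inv (jacobian_mat f x) *v ((1 / fact k) *s higher_deriv k f x vs))))
      else \<infinity>)"

definition smale_alpha ::
    "('n::finite, 'a::ultrametric_field) mpoly ^ 'n \<Rightarrow> 'a ^ 'n \<Rightarrow> ennreal" where
  "smale_alpha f x = smale_beta f x * smale_gamma f x"

text \<open>If there are no zeros, the infimum is \<open>\<infinity>\<close>.\<close>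

definition dist_to_zeros ::
    "('n::finite, 'a::ultrametric_field) mpoly ^ 'n \<Rightarrow> 'a ^ 'n \<Rightarrow> ennreal" where
  "dist_to_zeros f x = (INF z\<in>{z. map_eval f z = 0}. ennreal (vnorm (x - z)))"

text \<open>Only meaningful where the Jacobian is invertible.\<close>

definition newton ::
    "('n::finite, 'a::ultrametric_field) mpoly ^ 'n \<Rightarrow> 'a ^ 'n \<Rightarrow> 'a ^ 'n" where
  "newton f x = x - matrix_inv (jacobian_mat f x) *v map_eval f x"

definition converges_quadratically ::
    "(nat \<Rightarrow> 'a::ultrametric_field ^ 'n) \<Rightarrow> 'a ^ 'n \<Rightarrow> bool" where
  "converges_quadratically X L \<longleftrightarrow>
     (\<lambda>k. vnorm (X k - L)) \<longlonglongrightarrow> 0 \<and>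
     (\<exists>C. \<forall>k. vnorm (X (Suc k) - L) \<le> C * (vnorm (X k - L))\<^sup>2)"

end

theory Submission
  imports Defs
begin

text \<open>
  Write \<open>J\<close> for the Jacobian at \<open>x\<close>. Binomial coefficients have absolute value at most 1, so
  re-expanding the Taylor series at \<open>x + v\<close> shows that \<open>\<gamma> \<parallel>v\<parallel> < 1\<close> makes
  \<open>J\<^sup>-\<^sup>1 D\<^bsub>x+v\<^esub>f\<close> a perturbation of the identity of norm less than 1, hence an isometry, and that any
  bound for \<open>\<gamma>\<close> at \<open>x\<close> remains one at \<open>x + v\<close>. With \<open>v\<close> the Newton correction, the terms of
  order 0 and 1 in the expansion of \<open>J\<^sup>-\<^sup>1 f(x + v)\<close> cancel, so \<open>\<beta>\<close> becomes at most \<open>\<gamma> \<beta>\<^sup>2\<close>. The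
  step lengths strictly decrease, so by the ultrametric inequality the first remaining step
  equals the distance to the limit. Conversely, expanding \<open>f\<close> at \<open>x\<close> and evaluating at a zero
  closer than \<open>1 / \<gamma>\<close> bounds \<open>\<beta>\<close> by the distance to it.
\<close>

section \<open>Ultrametric absolute value and maximum norm\<close>

lemma absval_eq_dist: "absval x = dist x (0::'a::ultrametric_field)"
  by (simp add: dist_absval)

lemma absval_nonneg [simp]: "absval (x::'a::ultrametric_field) \<ge> 0"
  by (simp add: absval_eq_dist)

lemma absval_eq_0_iff [simp]: "absval (x::'a::ultrametric_field) = 0 \<longleftrightarrow> x = 0"
  by (simp add: absval_eq_dist)

lemma absval_0 [simp]: "absval (0::'a::ultrametric_field) = 0"
  by simp

lemma absval_1 [simp]: "absval (1::'a::ultrametric_field) = 1"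
  using absval_mult[of "1::'a" 1] absval_eq_0_iff[of "1::'a"] by (auto simp del: absval_eq_0_iff)

text \<open>Symmetry of the metric between \<open>x\<close> and 0, read through
  \<open>dist_absval\<close>.\<close>

lemma absval_minus [simp]: "absval (- x) = absval (x::'a::ultrametric_field)"
  using dist_commute[of x 0] by (simp add: dist_absval)

text \<open>The assumption \<open>B \<ge> 0\<close> takes care of empty and infinite index sets,
  whose sum is 0.\<close>

lemma absval_sum_le:
  fixes g :: "'b \<Rightarrow> 'a::ultrametric_field"
  assumes "\<And>a. a \<in> A \<Longrightarrow> absval (g a) \<le> B" "B \<ge> 0"
  shows "absval (sum g A) \<le> B"
  using assms
proof (induction A rule: infinite_finite_induct)
  case (insert a A)
  then show ?case
    using absval_ultrametric[of "g a" "sum g A"] by fastforce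
qed auto

text \<open>A sum of ones, bounded by the ultrametric inequality. Through it the binomial
  coefficients of the Taylor re-expansion drop out of every estimate.\<close>

lemma absval_of_nat_le_1: "absval (of_nat n :: 'a::ultrametric_field) \<le> 1"
proof -
  have "absval (\<Sum>i<n. 1 :: 'a) \<le> 1"
    by (rule absval_sum_le) auto
  then show ?thesis by simp
qed

lemma absval_prod: "absval (prod g A) = (\<Prod>a\<in>A. absval (g a :: 'a::ultrametric_field))"
  by (induction A rule: infinite_finite_induct) (auto simp: absval_mult)

lemma vnorm_ge_absval: "absval (v $ i) \<le> vnorm v"
  for v :: "'a::ultrametric_field ^ 'n"
  unfolding vnorm_def by (rule Max_ge) auto

lemma vnorm_le_iff: "vnorm v \<le> B \<longleftrightarrow> (\<forall>i. absval (v $ i) \<le> B)"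
  for v :: "'a::ultrametric_field ^ 'n"
  unfolding vnorm_def by (subst Max_le_iff) auto

lemma vnorm_nonneg [simp]: "vnorm v \<ge> 0"
  for v :: "'a::ultrametric_field ^ 'n"
  by (rule order_trans[OF absval_nonneg vnorm_ge_absval])

lemma vnorm_eq_0_iff [simp]: "vnorm v = 0 \<longleftrightarrow> v = 0"
  for v :: "'a::ultrametric_field ^ 'n"
  using vnorm_le_iff[of v 0] vnorm_nonneg[of v]
  by (auto simp: vec_eq_iff order_antisym_conv)

lemma vnorm_0 [simp]: "vnorm (0 :: 'a::ultrametric_field ^ 'n) = 0"
  by simp

lemma vnorm_pos_iff: "vnorm v > 0 \<longleftrightarrow> v \<noteq> 0"
  for v :: "'a::ultrametric_field ^ 'n"
  using vnorm_nonneg[of v] vnorm_eq_0_iff[of v] by linarith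

lemma vnorm_scale: "vnorm (c *s v) = absval c * vnorm v"
  for v :: "'a::ultrametric_field ^ 'n"
proof (rule antisym)
  show "vnorm (c *s v) \<le> absval c * vnorm v"
    by (auto simp: vnorm_le_iff absval_mult vnorm_ge_absval mult_left_mono)
  have "vnorm v \<in> range (\<lambda>i. absval (v $ i))"
    unfolding vnorm_def by (rule Max_in) auto
  then obtain i where "vnorm v = absval (v $ i)" by auto
  then show "absval c * vnorm v \<le> vnorm (c *s v)"
    using vnorm_ge_absval[of "c *s v" i] by (simp add: absval_mult)
qed

lemma vnorm_minus [simp]: "vnorm (- v) = vnorm v"
  for v :: "'a::ultrametric_field ^ 'n"
  by (simp add: vnorm_def)

lemma vnorm_minus_commute: "vnorm (v - w) = vnorm (w - v)"
  for v :: "'a::ultrametric_field ^ 'n"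
  using vnorm_minus[of "v - w"] by simp

lemma vnorm_add: "vnorm (v + w) \<le> max (vnorm v) (vnorm w)"
  for v :: "'a::ultrametric_field ^ 'n"
proof -
  have "absval (v $ i + w $ i) \<le> max (vnorm v) (vnorm w)" for i
    using absval_ultrametric[of "v $ i" "w $ i"] vnorm_ge_absval[of v i] vnorm_ge_absval[of w i]
    by linarith
  then show ?thesis by (simp add: vnorm_le_iff)
qed

lemma vnorm_add_le: "vnorm v \<le> B \<Longrightarrow> vnorm w \<le> B \<Longrightarrow> vnorm (v + w) \<le> B"
  for v :: "'a::ultrametric_field ^ 'n"
  using vnorm_add[of v w] by linarith

lemma vnorm_diff_le: "vnorm v \<le> B \<Longrightarrow> vnorm w \<le> B \<Longrightarrow> vnorm (v - w) \<le> B"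
  for v :: "'a::ultrametric_field ^ 'n"
  using vnorm_add[of v "- w"] by simp

text \<open>The isosceles principle: writing \<open>v\<close> as \<open>(v + w) - w\<close> bounds
  \<open>vnorm v\<close> by the maximum of \<open>vnorm (v + w)\<close> and the strictly smaller
  \<open>vnorm w\<close>.\<close>

lemma vnorm_add_eq: "vnorm w < vnorm v \<Longrightarrow> vnorm (v + w) = vnorm v"
  for v :: "'a::ultrametric_field ^ 'n"
  using vnorm_add[of v w] vnorm_add[of "v + w" "- w"] by auto

lemma vnorm_sum_le:
  fixes g :: "'b \<Rightarrow> 'a::ultrametric_field ^ 'n"
  assumes "\<And>a. a \<in> A \<Longrightarrow> vnorm (g a) \<le> B" "B \<ge> 0"
  shows "vnorm (sum g A) \<le> B"
  using assms
  by (auto simp: vnorm_le_iff intro!: absval_sum_le)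

subsection \<open>Taylor expansion\<close>

text \<open>Coefficients may cancel in a sum of polynomials, so key sets are first enlarged to a
  common finite set. The map \<open>h\<close> will be the embedding of coefficients as constant
  polynomials.\<close>

lemma sum_keys_superset:
  assumes "finite A" "Poly_Mapping.keys P \<subseteq> A" "h 0 = (0::'b::comm_semiring_1)"
  shows "(\<Sum>m\<in>Poly_Mapping.keys P. h (Poly_Mapping.lookup P m) * M m)
    = (\<Sum>m\<in>A. h (Poly_Mapping.lookup P m) * M m)"
  using assms by (intro sum.mono_neutral_left) (auto simp: Poly_Mapping.in_keys_iff)

lemma sum_keys_add:
  assumes "h 0 = (0::'b::comm_semiring_1)" "\<And>a b. h (a + b) = h a + h b"
  shows "(\<Sum>m\<in>Poly_Mapping.keys (P + Q). h (Poly_Mapping.lookup (P + Q) m) * M m)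
    = (\<Sum>m\<in>Poly_Mapping.keys P. h (Poly_Mapping.lookup P m) * M m)
      + (\<Sum>m\<in>Poly_Mapping.keys Q. h (Poly_Mapping.lookup Q m) * M m)"
proof -
  let ?A = "Poly_Mapping.keys P \<union> Poly_Mapping.keys Q"
  have "Poly_Mapping.keys (P + Q) \<subseteq> ?A"
    by (rule Poly_Mapping.keys_add)
  then have "(\<Sum>m\<in>Poly_Mapping.keys (P + Q). h (Poly_Mapping.lookup (P + Q) m) * M m)
      = (\<Sum>m\<in>?A. h (Poly_Mapping.lookup (P + Q) m) * M m)"
    using assms(1) by (intro sum_keys_superset) auto
  moreover have "(\<Sum>m\<in>Poly_Mapping.keys P. h (Poly_Mapping.lookup P m) * M m)
      = (\<Sum>m\<in>?A. h (Poly_Mapping.lookup P m) * M m)"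
    using assms(1) by (intro sum_keys_superset) auto
  moreover have "(\<Sum>m\<in>Poly_Mapping.keys Q. h (Poly_Mapping.lookup Q m) * M m)
      = (\<Sum>m\<in>?A. h (Poly_Mapping.lookup Q m) * M m)"
    using assms(1) by (intro sum_keys_superset) auto
  ultimately show ?thesis
    using assms(2) by (simp add: lookup_add sum.distrib distrib_right)
qed

text \<open>\<open>mpoly_deriv\<close> is a sum of this form. The exponents \<open>g k\<close> may
  coincide and the \<open>c k\<close> may vanish, so the sum is evaluated through additivity of
  \<open>h\<close>.\<close>

lemma sum_keys_sum_single:
  assumes "h 0 = (0::'b::comm_semiring_1)" "\<And>a b. h (a + b) = h a + h b" "finite K"
  shows "(\<Sum>m\<in>Poly_Mapping.keys (\<Sum>k\<in>K. Poly_Mapping.single (g k) (c k)).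
      h (Poly_Mapping.lookup (\<Sum>k\<in>K. Poly_Mapping.single (g k) (c k)) m) * M m)
    = (\<Sum>k\<in>K. h (c k) * M (g k))"
  using assms(3)
proof (induction K rule: finite_induct)
  case (insert k K)
  have "(\<Sum>m\<in>Poly_Mapping.keys (Poly_Mapping.single (g k) (c k)).
      h (Poly_Mapping.lookup (Poly_Mapping.single (g k) (c k)) m) * M m) = h (c k) * M (g k)"
    by (subst sum_keys_superset[of "{g k}"]) (use assms(1) in auto)
  with insert show ?case
    by (simp add: sum_keys_add[of h, OF assms(1,2)])
qed simp

lemma pderiv_sum: "pderiv (sum g A) = (\<Sum>a\<in>A. pderiv (g a))"
  using higher_pderiv_sum[of 1 g A] by simp

lemma smult_sum_right: "smult c (sum g A) = (\<Sum>a\<in>A. smult c (g a))"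
  by (induction A rule: infinite_finite_induct) (simp_all add: smult_add_right)

text \<open>Restricting to the line \<open>x + t *s v\<close> reduces the multivariate Taylor
  formula to the coefficients of a univariate polynomial in \<open>t\<close>.\<close>

definition line_restriction ::
    "'a::comm_semiring_1 ^ 'n \<Rightarrow> 'a ^ 'n \<Rightarrow> ('n::finite, 'a) mpoly \<Rightarrow> 'a poly" where
  "line_restriction x v P =
     (\<Sum>m\<in>Poly_Mapping.keys P.
        [:Poly_Mapping.lookup P m:] * (\<Prod>i\<in>UNIV. [:x $ i, v $ i:] ^ Poly_Mapping.lookup m i))"

lemma poly_line_restriction:
  "poly (line_restriction x v P) t = mpoly_eval P (x + t *s v)"
  by (simp add: line_restriction_def mpoly_eval_def poly_sum poly_prod poly_power)

text \<open>
  Iterating this derivative turns the univariate Taylor formula into the multivariate one, with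
  the partial derivatives in the order in which \<open>foldr\<close> applies them; their symmetry is not
  needed.
\<close>

lemma pderiv_line_restriction:
  fixes P :: "('n::finite, 'a::field_char_0) mpoly"
  shows "pderiv (line_restriction x v P)
    = (\<Sum>j\<in>UNIV. smult (v $ j) (line_restriction x v (mpoly_deriv j P)))"
proof -
  let ?M = "\<lambda>m. \<Prod>i\<in>UNIV. [:x $ i, v $ i:] ^ Poly_Mapping.lookup m i"
  have L: "line_restriction x v (mpoly_deriv j P) = (\<Sum>m\<in>Poly_Mapping.keys P.
      [:of_nat (Poly_Mapping.lookup m j) * Poly_Mapping.lookup P m:]
        * ?M (m - Poly_Mapping.single j 1))" for j
    unfolding line_restriction_def mpoly_deriv_def
    by (rule sum_keys_sum_single) auto
  have M: "pderiv (?M m) = (\<Sum>j\<in>UNIV. smult (of_nat (Poly_Mapping.lookup m j) * v $ j)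
      (?M (m - Poly_Mapping.single j 1)))" for m
  proof -
    have "(\<Prod>i\<in>UNIV - {j}. [:x $ i, v $ i:] ^ Poly_Mapping.lookup m i)
        * pderiv ([:x $ j, v $ j:] ^ Poly_Mapping.lookup m j)
      = smult (of_nat (Poly_Mapping.lookup m j) * v $ j) (?M (m - Poly_Mapping.single j 1))" for j
    proof -
      \<comment> \<open>Both sides truncate at exponent 0, so no case split arises; there the factor
        \<open>of_nat (Poly_Mapping.lookup m j)\<close> vanishes together with the
        derivative.\<close>
      have "?M (m - Poly_Mapping.single j 1) = [:x $ j, v $ j:] ^ (Poly_Mapping.lookup m j - 1)
          * (\<Prod>i\<in>UNIV - {j}. [:x $ i, v $ i:] ^ Poly_Mapping.lookup m i)"
        by (subst prod.remove[of _ j])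
          (auto simp: lookup_minus lookup_single when_def intro!: prod.cong)
      then show ?thesis
        by (simp add: pderiv_power pderiv_pCons mult_ac)
    qed
    then show ?thesis by (simp add: pderiv_prod)
  qed
  have "pderiv (line_restriction x v P)
      = (\<Sum>m\<in>Poly_Mapping.keys P. \<Sum>j\<in>UNIV. smult (v $ j)
        ([:of_nat (Poly_Mapping.lookup m j) * Poly_Mapping.lookup P m:]
        * ?M (m - Poly_Mapping.single j 1)))"
    unfolding line_restriction_def
    by (auto simp: pderiv_sum pderiv_smult M smult_sum_right intro!: sum.cong)
       (simp add: mult_ac)
  also have "\<dots> = (\<Sum>j\<in>UNIV. smult (v $ j) (line_restriction x v (mpoly_deriv j P)))"
    unfolding L smult_sum_right by (rule sum.swap)
  finally show ?thesis .
qed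

lemma sum_lists_Suc:
  fixes g :: "'n::finite list \<Rightarrow> 'b::comm_monoid_add"
  shows "(\<Sum>js\<in>{js. length js = Suc k}. g js)
    = (\<Sum>js\<in>{js. length js = k}. \<Sum>j\<in>UNIV. g (j # js))"
proof -
  have "{js :: 'n list. length js = Suc k} = (\<lambda>(js, j). j # js) ` ({js. length js = k} \<times> UNIV)"
    by (auto simp: length_Suc_conv image_iff)
  then have "(\<Sum>js\<in>{js. length js = Suc k}. g js)
      = (\<Sum>p\<in>{js. length js = k} \<times> UNIV. g (snd p # fst p))"
    by (simp add: sum.reindex inj_on_def case_prod_unfold)
  then show ?thesis
    by (simp add: sum.cartesian_product case_prod_unfold)
qed

lemma finite_lists_length_eq_UNIV [simp]: "finite {js :: 'n::finite list. length js = k}"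
  using finite_lists_length_eq[of "UNIV :: 'n set" k] by simp

text \<open>\<open>foldr\<close> applies the head of the list last, so one more derivative prepends
  an index; \<open>sum_lists_Suc\<close> matches this recursion.\<close>

lemma higher_pderiv_line_restriction:
  fixes P :: "('n::finite, 'a::field_char_0) mpoly"
  shows "(pderiv ^^ k) (line_restriction x v P)
    = (\<Sum>js\<in>{js. length js = k}.
        smult (\<Prod>l<k. v $ (js ! l)) (line_restriction x v (foldr mpoly_deriv js P)))"
proof (induction k)
  case (Suc k)
  show ?case
    by (simp add: Suc.IH pderiv_sum pderiv_smult pderiv_line_restriction sum_lists_Suc
        smult_sum_right prod.lessThan_Suc_shift mult_ac del: prod.lessThan_Suc)
qed simp

section \<open>Total degree and vanishing of high derivatives\<close>

definition mdegree :: "('n::finite \<Rightarrow>\<^sub>0 nat) \<Rightarrow> nat" where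
  "mdegree m = (\<Sum>i\<in>UNIV. Poly_Mapping.lookup m i)"

text \<open>The strict bound avoids choosing a degree for the zero polynomial: \<open>d = 0\<close>
  says that no monomial is left.\<close>

lemma mdegree_mpoly_deriv:
  assumes "\<forall>m\<in>Poly_Mapping.keys P. mdegree m < Suc d"
  shows "\<forall>m\<in>Poly_Mapping.keys (mpoly_deriv j P). mdegree m < d"
proof
  fix m assume "m \<in> Poly_Mapping.keys (mpoly_deriv j P)"
  then obtain m' where m': "m' \<in> Poly_Mapping.keys P"
    "m \<in> Poly_Mapping.keys (Poly_Mapping.single (m' - Poly_Mapping.single j 1)
          (of_nat (Poly_Mapping.lookup m' j) * Poly_Mapping.lookup P m'))"
    using keys_sum unfolding mpoly_deriv_def by fast
  \<comment> \<open>A key of \<open>single\<close> has a nonzero coefficient, which forces a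
    positive exponent of \<open>j\<close> in \<open>m'\<close>; hence the truncated subtraction
    really lowers the degree.\<close>
  then have m: "m = m' - Poly_Mapping.single j 1" and pos: "Poly_Mapping.lookup m' j \<noteq> 0"
    by (auto split: if_splits intro!: gr0I)
  have "mdegree m < mdegree m'"
    unfolding mdegree_def using pos
    by (intro sum_strict_mono_ex1) (auto simp: m lookup_minus lookup_single when_def)
  with assms m' show "mdegree m < d" by fastforce
qed

lemma foldr_mpoly_deriv_eq_0:
  assumes "\<forall>m\<in>Poly_Mapping.keys P. mdegree m < length js"
  shows "foldr mpoly_deriv js P = 0"
proof -
  \<comment> \<open>The slack \<open>d\<close> carries the induction over \<open>js\<close>; at
    \<open>d = 0\<close> no monomial survives.\<close>
  have "\<forall>m\<in>Poly_Mapping.keys (foldr mpoly_deriv js P). mdegree m < d"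
    if "\<forall>m\<in>Poly_Mapping.keys P. mdegree m < length js + d" for d
    using that
  proof (induction js arbitrary: d)
    case (Cons j js)
    then show ?case
      using mdegree_mpoly_deriv[of "foldr mpoly_deriv js P" d j] Cons.IH[of "Suc d"] by simp
  qed simp
  from this[of 0] assms show ?thesis
    by (auto simp flip: keys_eq_empty)
qed

text \<open>One cutoff serves all components, so every Taylor expansion below is a finite
  sum.\<close>

lemma foldr_mpoly_deriv_eventually_0:
  fixes f :: "('n::finite, 'a::comm_semiring_1) mpoly ^ 'q"
  obtains d where "\<forall>i js. length js \<ge> d \<longrightarrow> foldr mpoly_deriv js (f $ i) = 0"
proof -
  let ?A = "\<Union>i\<in>UNIV. mdegree ` Poly_Mapping.keys (f $ i)"
  have "finite ?A" by auto
  then obtain d where d: "\<forall>n\<in>?A. n < d"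
    using finite_nat_set_iff_bounded by blast
  show ?thesis
  proof (rule that, intro allI impI)
    fix i and js :: "'n list"
    assume "length js \<ge> d"
    then show "foldr mpoly_deriv js (f $ i) = 0"
      using d by (intro foldr_mpoly_deriv_eq_0) force
  qed
qed

text \<open>The \<open>l\<close>-th coefficient of the restriction to the line is its
  \<open>l\<close>-th derivative at 0 divided by \<open>fact l\<close>, which characteristic zero
  permits; the formula is the value at \<open>t = 1\<close>.\<close>

lemma mpoly_taylor:
  fixes P :: "('n::finite, 'a::field_char_0) mpoly"
  assumes "\<And>js. length js \<ge> d \<Longrightarrow> foldr mpoly_deriv js P = 0"
  shows "mpoly_eval P (x + v) = (\<Sum>l<d. (1 / fact l) *
    (\<Sum>js\<in>{js. length js = l}. mpoly_eval (foldr mpoly_deriv js P) x * (\<Prod>i<l. v $ (js ! i))))"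
proof -
  let ?p = "line_restriction x v P"
  have c: "coeff ?p l = (1 / fact l) *
    (\<Sum>js\<in>{js. length js = l}. mpoly_eval (foldr mpoly_deriv js P) x * (\<Prod>i<l. v $ (js ! i)))" for l
  proof -
    have "fact l * coeff ?p l = coeff ((pderiv ^^ l) ?p) 0"
      by (simp add: coeff_higher_pderiv pochhammer_fact)
    also have "\<dots> = poly ((pderiv ^^ l) ?p) 0"
      by (simp add: poly_0_coeff_0)
    also have "\<dots> = (\<Sum>js\<in>{js. length js = l}.
        mpoly_eval (foldr mpoly_deriv js P) x * (\<Prod>i<l. v $ (js ! i)))"
      by (simp add: higher_pderiv_line_restriction poly_sum poly_line_restriction mult_ac)
    finally show ?thesis by (simp add: field_simps)
  qed
  have "coeff ?p l = 0" if "l \<ge> d" for l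
    unfolding c using that assms by (simp add: mpoly_eval_def)
  then have "poly ?p 1 = (\<Sum>l<d. coeff ?p l)"
    unfolding poly_altdef
    by (intro sum.mono_neutral_cong) (auto simp: not_less intro: le_degree)
  then show ?thesis by (simp add: poly_line_restriction c)
qed

lemma sum_lists_append:
  fixes g :: "'n::finite list \<Rightarrow> 'b::comm_monoid_add"
  shows "(\<Sum>js\<in>{js. length js = l + k}. g js)
    = (\<Sum>is\<in>{is. length is = l}. \<Sum>js\<in>{js. length js = k}. g (is @ js))"
proof (induction l arbitrary: g)
  case (Suc l)
  have "(\<Sum>js\<in>{js. length js = Suc l + k}. g js)
      = (\<Sum>is\<in>{is. length is = l}. \<Sum>js\<in>{js. length js = k}. \<Sum>j\<in>UNIV. g (j # is @ js))"
    using Suc.IH[of "\<lambda>js. \<Sum>j\<in>UNIV. g (j # js)"] by (simp add: sum_lists_Suc)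
  also have "\<dots> = (\<Sum>is\<in>{is. length is = l}. \<Sum>j\<in>UNIV. \<Sum>js\<in>{js. length js = k}. g (j # is @ js))"
    by (intro sum.cong sum.swap refl)
  finally show ?case by (simp add: sum_lists_Suc)
qed simp

lemma prod_lessThan_add:
  fixes l k :: nat
  shows "prod g {..<l + k} = prod g {..<l} * (\<Prod>i<k. g (l + i) :: 'b::comm_monoid_mult)"
  by (induction k) (simp_all add: mult_ac)

text \<open>Taylor's formula is applied to each iterated partial derivative separately. The new
  derivatives stand in front of the old ones in the index list, hence \<open>v\<close> fills the
  first \<open>l\<close> slots.\<close>

lemma higher_deriv_taylor:
  fixes f :: "('n::finite, 'a::field_char_0) mpoly ^ 'q"
  assumes d: "\<forall>i js. length js \<ge> d \<longrightarrow> foldr mpoly_deriv js (f $ i) = 0"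
    and k: "length us = k"
  shows "higher_deriv k f (x + v) us
    = (\<Sum>l<d. (1 / fact l) *s higher_deriv (l + k) f x (replicate l v @ us))"
proof -
  have "higher_deriv k f (x + v) us $ i
    = (\<Sum>l<d. (1 / fact l) *s higher_deriv (l + k) f x (replicate l v @ us)) $ i" for i
  proof -
    let ?E = "\<lambda>is js. mpoly_eval (foldr mpoly_deriv is (foldr mpoly_deriv js (f $ i))) x"
    let ?V = "\<lambda>is l. \<Prod>i<l. v $ (is ! i)"
    let ?U = "\<lambda>js. \<Prod>l<k. us ! l $ (js ! l)"
    have "mpoly_eval (foldr mpoly_deriv js (f $ i)) (x + v)
        = (\<Sum>l<d. (1 / fact l) * (\<Sum>is\<in>{is. length is = l}. ?E is js * ?V is l))" for js
      by (rule mpoly_taylor) (use d[rule_format, where js = "_ @ js" and i = i] in simp)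
    then have "higher_deriv k f (x + v) us $ i
      = (\<Sum>js\<in>{js. length js = k}. \<Sum>l<d. (1 / fact l) *
          (\<Sum>is\<in>{is. length is = l}. ?E is js * ?V is l * ?U js))"
      by (simp add: higher_deriv_def sum_distrib_right mult.assoc)
    also have "\<dots> = (\<Sum>l<d. (1 / fact l) *
        (\<Sum>is\<in>{is. length is = l}. \<Sum>js\<in>{js. length js = k}. ?E is js * ?V is l * ?U js))"
      by (subst sum.swap, subst (2) sum.swap) (simp add: sum_distrib_left)
    also have "\<dots> = (\<Sum>l<d. (1 / fact l) * higher_deriv (l + k) f x (replicate l v @ us) $ i)"
      by (intro sum.cong refl arg_cong2[where f = times])
        (auto simp: higher_deriv_def sum_lists_append prod_lessThan_add nth_append mult.assoc
          intro!: sum.cong prod.cong arg_cong2[where f = times])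
    finally show ?thesis by simp
  qed
  then show ?thesis by (simp add: vec_eq_iff)
qed

section \<open>Taylor coefficients normalised by the inverse Jacobian\<close>

lemma higher_deriv_0: "higher_deriv 0 f x [] = map_eval f x"
  by (simp add: higher_deriv_def map_eval_def)

lemma higher_deriv_1: "higher_deriv (Suc 0) f x [u] = jacobian_mat f x *v u"
  by (simp add: higher_deriv_def jacobian_mat_def matrix_vector_mult_def sum_lists_Suc)

lemma matrix_inv_vector_cancel:
  assumes "invertible (A :: 'a::field ^ 'n ^ 'n)"
  shows "matrix_inv A *v (A *v u) = u" "A *v (matrix_inv A *v u) = u"
proof -
  have "A ** matrix_inv A = mat 1 \<and> matrix_inv A ** A = mat 1"
    using assms unfolding invertible_def matrix_inv_def by (rule someI_ex)
  then show "matrix_inv A *v (A *v u) = u" "A *v (matrix_inv A *v u) = u"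
    by (simp_all add: matrix_vector_mul_assoc)
qed

lemma matrix_vector_mult_sum:
  fixes A :: "'a::field ^ 'n ^ 'm" and g :: "'b \<Rightarrow> 'a ^ 'n"
  shows "A *v (\<Sum>a\<in>S. g a) = (\<Sum>a\<in>S. A *v g a)"
  by (induction S rule: infinite_finite_induct) (simp_all add: matrix_vector_right_distrib)

text \<open>For \<open>k \<ge> 2\<close> this is the multilinear map in the definition of
  \<open>smale_gamma\<close>. Order 0 gives the Newton correction and, where the Jacobian is
  invertible, order 1 gives the identity.\<close>

definition taylor_term ::
    "('n::finite, 'a::field_char_0) mpoly ^ 'n \<Rightarrow> 'a ^ 'n \<Rightarrow> nat \<Rightarrow> ('a ^ 'n) list \<Rightarrow> 'a ^ 'n" where
  "taylor_term f x k us =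
     matrix_inv (jacobian_mat f x) *v ((1 / fact k) *s higher_deriv k f x us)"

lemma taylor_term_0: "taylor_term f x 0 [] = matrix_inv (jacobian_mat f x) *v map_eval f x"
  by (simp add: taylor_term_def higher_deriv_0)

lemma taylor_term_1: "invertible (jacobian_mat f x) \<Longrightarrow> taylor_term f x (Suc 0) [u] = u"
  by (simp add: taylor_term_def higher_deriv_1 matrix_inv_vector_cancel)

lemma taylor_term_eq_0:
  assumes "\<forall>i js. length js \<ge> d \<longrightarrow> foldr mpoly_deriv js (f $ i) = 0" "k \<ge> d"
  shows "taylor_term f x k us = 0"
proof -
  have "higher_deriv k f x us = 0"
    using assms by (simp add: higher_deriv_def vec_eq_iff mpoly_eval_def)
  then show ?thesis by (simp add: taylor_term_def)
qed

text \<open>The inverse Jacobian stays at \<open>x\<close> while the derivative moves to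
  \<open>x + v\<close>. The factorials combine to a binomial coefficient, an integer and hence of
  absolute value at most 1.\<close>

lemma taylor_term_shift:
  assumes "\<forall>i js. length js \<ge> d \<longrightarrow> foldr mpoly_deriv js (f $ i) = 0" "length us = k"
  shows "matrix_inv (jacobian_mat f x) *v ((1 / fact k) *s higher_deriv k f (x + v) us)
    = (\<Sum>l<d. of_nat ((l + k) choose k) *s taylor_term f x (l + k) (replicate l v @ us))"
proof -
  have "1 / fact k * (1 / fact l) = (of_nat ((l + k) choose k) * (1 / fact (l + k)) :: 'b)" for l
    by (simp add: binomial_fact)
  then show ?thesis
    by (simp add: higher_deriv_taylor[OF assms] taylor_term_def matrix_vector_mult_sum
        vec.scale_sum_right vec.scale_scale vector_scalar_commute vector_smult_assoc del: of_nat_add)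
qed

subsection \<open>Bounds on the Taylor coefficients\<close>

lemma matrix_vector_mult_bound:
  fixes A :: "'a::ultrametric_field ^ 'n ^ 'm"
  obtains K where "K \<ge> 0" "\<And>w. vnorm (A *v w) \<le> K * vnorm w"
proof
  let ?K = "\<Sum>i\<in>UNIV. \<Sum>j\<in>UNIV. absval (A $ i $ j)"
  show "?K \<ge> 0" by (intro sum_nonneg) auto
  fix w :: "'a ^ 'n"
  have le: "absval (A $ i $ j) \<le> ?K" for i j
    by (rule order_trans[OF member_le_sum[of j UNIV] member_le_sum[of i UNIV]])
      (auto intro!: sum_nonneg)
  have "absval (A $ i $ j * w $ j) \<le> ?K * vnorm w" for i j
    unfolding absval_mult by (intro mult_mono le vnorm_ge_absval) (auto intro!: sum_nonneg)
  then show "vnorm (A *v w) \<le> ?K * vnorm w"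
    by (auto simp: vnorm_le_iff matrix_vector_mult_def sum_nonneg intro!: absval_sum_le)
qed

lemma prod_list_vnorm_nonneg [simp]: "prod_list (map vnorm us) \<ge> 0"
  by (induction us) auto

lemma prod_absval_nth_le:
  fixes us :: "('a::ultrametric_field ^ 'n) list"
  shows "(\<Prod>l<length us. absval (us ! l $ (js l))) \<le> prod_list (map vnorm us)"
proof (induction us arbitrary: js)
  case (Cons u us)
  show ?case
    using Cons.IH[of "\<lambda>l. js (Suc l)"]
    by (auto simp: prod.lessThan_Suc_shift vnorm_ge_absval simp del: prod.lessThan_Suc
        intro!: mult_mono prod_nonneg)
qed simp

lemma higher_deriv_bound:
  fixes f :: "('n::finite, 'a::ultrametric_field) mpoly ^ 'q"
  obtains C where "C \<ge> 0"
    "\<And>us. length us = k \<Longrightarrow> vnorm (higher_deriv k f x us) \<le> C * prod_list (map vnorm us)"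
proof
  let ?E = "\<lambda>i js. absval (mpoly_eval (foldr mpoly_deriv js (f $ i)) x)"
  let ?J = "{js :: 'n list. length js = k}"
  let ?C = "\<Sum>i\<in>UNIV. \<Sum>js\<in>?J. ?E i js"
  show C: "?C \<ge> 0" by (intro sum_nonneg) auto
  fix us :: "('a ^ 'n) list" assume us: "length us = k"
  have le: "?E i js \<le> ?C" if "js \<in> ?J" for i js
    by (rule order_trans[OF member_le_sum[of js ?J] member_le_sum[of i UNIV]])
      (use that in \<open>auto intro!: sum_nonneg\<close>)
  have "absval (higher_deriv k f x us $ i) \<le> ?C * prod_list (map vnorm us)" for i
    unfolding higher_deriv_def vec_lambda_beta absval_mult
  proof (intro absval_sum_le mult_nonneg_nonneg C prod_list_vnorm_nonneg)
    fix js assume "js \<in> ?J"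
    then show "absval (mpoly_eval (foldr mpoly_deriv js (f $ i)) x * (\<Prod>l<k. us ! l $ (js ! l)))
        \<le> ?C * prod_list (map vnorm us)"
      using prod_absval_nth_le[of us "\<lambda>l. js ! l"] us le C unfolding absval_mult absval_prod
      by (intro mult_mono) (auto intro!: prod_nonneg)
  qed
  then show "vnorm (higher_deriv k f x us) \<le> ?C * prod_list (map vnorm us)"
    by (simp add: vnorm_le_iff)
qed

text \<open>Only the existence of some \<open>C\<close> matters: it bounds the supremum in
  \<open>multilinear_norm\<close> and leads to the finiteness of \<gamma>.\<close>

lemma taylor_term_bound:
  fixes f :: "('n::finite, 'a::ultrametric_field) mpoly ^ 'n"
  obtains C where "C \<ge> 0"
    "\<And>us. length us = k \<Longrightarrow> vnorm (taylor_term f x k us) \<le> C * prod_list (map vnorm us)"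
proof -
  obtain K where K: "K \<ge> 0" "\<And>w. vnorm (matrix_inv (jacobian_mat f x) *v w) \<le> K * vnorm w"
    using matrix_vector_mult_bound by blast
  obtain C where C: "C \<ge> 0"
    "\<And>us. length us = k \<Longrightarrow> vnorm (higher_deriv k f x us) \<le> C * prod_list (map vnorm us)"
    using higher_deriv_bound[of k f x] by blast
  let ?C = "K * (absval (1 / fact k :: 'a) * C)"
  show ?thesis
  proof
    show "?C \<ge> 0" using K C by simp
    fix us :: "('a ^ 'n) list" assume "length us = k"
    then have "absval (1 / fact k :: 'a) * vnorm (higher_deriv k f x us)
        \<le> absval (1 / fact k :: 'a) * (C * prod_list (map vnorm us))"
      by (intro mult_left_mono C) auto
    then show "vnorm (taylor_term f x k us) \<le> ?C * prod_list (map vnorm us)"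
      using order_trans[OF K(2) mult_left_mono[OF _ K(1)]]
      by (simp add: taylor_term_def vnorm_scale mult.assoc)
  qed
qed

section \<open>Real upper bounds for \<gamma>\<close>

text \<open>At an invertible Jacobian this expresses \<gamma> \<le> \<open>G\<close> without roots,
  quotients or extended reals, and it also covers tuples that contain the zero vector.\<close>

definition gamma_bound ::
    "('n::finite, 'a::ultrametric_field) mpoly ^ 'n \<Rightarrow> 'a ^ 'n \<Rightarrow> real \<Rightarrow> bool" where
  "gamma_bound f x G \<longleftrightarrow> G \<ge> 0 \<and> (\<forall>k\<ge>2. \<forall>us. length us = k \<longrightarrow>
     vnorm (taylor_term f x k us) \<le> G ^ (k - 1) * prod_list (map vnorm us))"

lemma gamma_boundD:
  assumes "gamma_bound f x G" "k \<ge> 2" "length us = k"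
  shows "vnorm (taylor_term f x k us) \<le> G ^ (k - 1) * prod_list (map vnorm us)"
  using assms unfolding gamma_bound_def by blast

text \<open>Only finitely many orders contribute. The summand 1 in \<open>G\<close> gives
  \<open>G \<ge> 1\<close>, so that \<open>G \<le> G ^ (k - 1)\<close> for
  \<open>k \<ge> 2\<close>.\<close>

lemma ex_gamma_bound:
  fixes f :: "('n::finite, 'a::ultrametric_field) mpoly ^ 'n"
  obtains G where "gamma_bound f x G"
proof -
  obtain d where d: "\<forall>i js. length js \<ge> d \<longrightarrow> foldr mpoly_deriv js (f $ i) = 0"
    using foldr_mpoly_deriv_eventually_0[of f] by blast
  have "\<exists>C\<ge>0. \<forall>us. length us = k \<longrightarrow>
      vnorm (taylor_term f x k us) \<le> C * prod_list (map vnorm us)" for k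
    using taylor_term_bound[of k f x] by metis
  then obtain C where C: "\<And>k. C k \<ge> (0::real)" "\<And>k us. length us = k \<Longrightarrow>
      vnorm (taylor_term f x k us) \<le> C k * prod_list (map vnorm us)"
    by metis
  define G where "G = 1 + (\<Sum>k<d. C k)"
  have G: "G \<ge> 1" using C(1) by (simp add: G_def sum_nonneg)
  have "vnorm (taylor_term f x k us) \<le> G ^ (k - 1) * prod_list (map vnorm us)"
    if "k \<ge> 2" "length us = k" for k us
  proof (cases "k < d")
    case True
    then have "C k \<le> G"
      using C(1) member_le_sum[of k "{..<d}" C] by (simp add: G_def)
    also have "G \<le> G ^ (k - 1)"
      using power_increasing[of 1 "k - 1" G] that G by simp
    finally show ?thesis
      using order_trans[OF C(2)[OF that(2)] mult_right_mono] by simp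
  qed (use G d in \<open>simp add: taylor_term_eq_0[of d]\<close>)
  then show ?thesis
    using that[of G] G by (simp add: gamma_bound_def)
qed

lemma multilinear_norm_set_nonempty:
  "{vs :: ('a::ultrametric_field ^ 'n) list. length vs = k \<and> 0 \<notin> set vs} \<noteq> {}"
proof -
  have "(1 :: 'a ^ 'n) \<noteq> 0" by (simp add: vec_eq_iff)
  then have "replicate k (1 :: 'a ^ 'n) \<in> {vs. length vs = k \<and> 0 \<notin> set vs}" by auto
  then show ?thesis by blast
qed

lemma prod_list_vnorm_pos: "0 \<notin> set us \<Longrightarrow> prod_list (map vnorm us) > 0"
  by (induction us) (auto simp: vnorm_pos_iff)

lemma smale_gamma_le:
  assumes "invertible (jacobian_mat f x)" "gamma_bound f x G"
  shows "smale_gamma f x \<le> ennreal G"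
proof -
  have "root (k - 1) (multilinear_norm k (taylor_term f x k)) \<le> G" if k: "k \<ge> 2" for k
  proof -
    have "multilinear_norm k (taylor_term f x k) \<le> G ^ (k - 1)"
      unfolding multilinear_norm_def using gamma_boundD[OF assms(2) k]
      by (intro cSUP_least multilinear_norm_set_nonempty)
        (auto simp: pos_divide_le_eq prod_list_vnorm_pos)
    then have "root (k - 1) (multilinear_norm k (taylor_term f x k)) \<le> root (k - 1) (G ^ (k - 1))"
      using k by simp
    also have "\<dots> = G"
      using k assms(2) by (intro real_root_power_cancel) (auto simp: gamma_bound_def)
    finally show ?thesis .
  qed
  then show ?thesis
    using assms unfolding smale_gamma_def taylor_term_def
    by (auto intro!: SUP_least ennreal_leI)
qed

lemma smale_gamma_less_top:
  assumes "invertible (jacobian_mat f x)"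
  shows "smale_gamma f x < \<infinity>"
  using ex_gamma_bound[of f x] smale_gamma_le[OF assms] by (metis ennreal_less_top le_less_trans infinity_ennreal_def)

text \<open>The counterpart of \<open>smale_gamma_le\<close>: \<gamma> is itself an admissible
  bound, so estimates proved for an arbitrary \<open>G\<close> apply to its real value.\<close>

lemma gamma_bound_smale_gamma:
  fixes f :: "('n::finite, 'a::ultrametric_field) mpoly ^ 'n"
  assumes inv: "invertible (jacobian_mat f x)"
  shows "gamma_bound f x (enn2real (smale_gamma f x))"
  unfolding gamma_bound_def
proof (intro conjI allI impI)
  let ?G = "enn2real (smale_gamma f x)"
  fix k :: nat and us :: "('a ^ 'n) list" assume k: "2 \<le> k" and us: "length us = k"
  let ?N = "multilinear_norm k (taylor_term f x k)"
  obtain C where C: "C \<ge> 0"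
    "\<And>us. length us = k \<Longrightarrow> vnorm (taylor_term f x k us) \<le> C * prod_list (map vnorm us)"
    using taylor_term_bound[of k f x] by blast
  have bdd: "bdd_above ((\<lambda>vs. vnorm (taylor_term f x k vs) / prod_list (map vnorm vs))
      ` {vs. length vs = k \<and> 0 \<notin> set vs})"
    using C by (intro bdd_aboveI2[of _ _ C]) (auto simp: pos_divide_le_eq prod_list_vnorm_pos)
  have upper: "vnorm (taylor_term f x k vs) / prod_list (map vnorm vs) \<le> ?N"
    if "length vs = k" "0 \<notin> set vs" for vs
    unfolding multilinear_norm_def using that by (intro cSUP_upper bdd) auto
  \<comment> \<open>Nonnegativity of the supremum is what lets the power \<open>k - 1\<close> undo
    the root.\<close>
  have N: "?N \<ge> 0"
    using multilinear_norm_set_nonempty[of k] upper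
    by (metis (mono_tags, lifting) divide_nonneg_nonneg empty_Collect_eq order_trans
        prod_list_vnorm_nonneg vnorm_nonneg)
  have "ennreal (root (k - 1) ?N) \<le> smale_gamma f x"
    using inv k unfolding smale_gamma_def taylor_term_def by (auto intro!: SUP_upper2[of k])
  also have "\<dots> = ennreal ?G"
    using smale_gamma_less_top[OF inv] by simp
  finally have "root (k - 1) ?N ^ (k - 1) \<le> ?G ^ (k - 1)"
    using k N by (intro power_mono) auto
  then have NG: "?N \<le> ?G ^ (k - 1)"
    using k N by simp
  show "vnorm (taylor_term f x k us) \<le> ?G ^ (k - 1) * prod_list (map vnorm us)"
  proof (cases "0 \<in> set us")
    \<comment> \<open>Such tuples lie outside the supremum; the crude bound with \<open>C\<close>
      makes the term vanish.\<close>
    case True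
    then have "prod_list (map vnorm us) = 0" by (force simp: prod_list_zero_iff)
    then show ?thesis using C(2)[OF us] by simp
  next
    case False
    then show ?thesis
      using order_trans[OF upper[OF us False] NG]
      by (simp add: pos_divide_le_eq prod_list_vnorm_pos)
  qed
qed simp

subsection \<open>Perturbation of the base point\<close>

context
  fixes f :: "('n::finite, 'a::ultrametric_field) mpoly ^ 'n" and x v :: "'a ^ 'n" and G :: real
  assumes inv: "invertible (jacobian_mat f x)"
    and bound: "gamma_bound f x G"
    and small: "G * vnorm v < 1"
begin

lemma bound_nonneg: "G \<ge> 0"
  using bound by (simp add: gamma_bound_def)

lemma small_power: "(G * vnorm v) ^ l \<le> 1"
  using small bound_nonneg by (intro power_le_one) auto

text \<open>The \<open>l\<close> slots filled with \<open>v\<close> give the power of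
  \<open>vnorm v\<close>, and the integer factor \<open>c\<close> cannot increase the norm.\<close>

lemma shifted_term_bound:
  assumes "l + k \<ge> 2" "length us = k"
  shows "vnorm (of_nat c *s taylor_term f x (l + k) (replicate l v @ us))
    \<le> G ^ (l + k - 1) * vnorm v ^ l * prod_list (map vnorm us)"
proof -
  have "absval (of_nat c :: 'a) * vnorm (taylor_term f x (l + k) (replicate l v @ us))
      \<le> vnorm (taylor_term f x (l + k) (replicate l v @ us))"
    by (rule mult_left_le_one_le) (auto simp: absval_of_nat_le_1)
  also have "\<dots> \<le> G ^ (l + k - 1) * prod_list (map vnorm (replicate l v @ us))"
    using assms by (intro gamma_boundD[OF bound]) auto
  finally show ?thesis by (simp add: vnorm_scale mult.assoc)
qed

text \<open>The Taylor terms of order 0 and 1 are the Newton correction and \<open>v\<close>. Each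
  later term is at most the quadratic bound times a power of \<open>G * vnorm v\<close>, so the
  ultrametric inequality gives the same bound for their sum.\<close>

lemma newton_residual:
  "vnorm (matrix_inv (jacobian_mat f x) *v map_eval f (x + v)
      - (matrix_inv (jacobian_mat f x) *v map_eval f x + v)) \<le> G * (vnorm v)\<^sup>2"
proof -
  obtain d where d: "\<forall>i js. length js \<ge> d \<longrightarrow> foldr mpoly_deriv js (f $ i) = 0"
    using foldr_mpoly_deriv_eventually_0[of f] by blast
  \<comment> \<open>Raising the cutoff by two lets the first two terms be split off whatever
    \<open>d\<close> is.\<close>
  then have d2: "\<forall>i js. length js \<ge> Suc (Suc d) \<longrightarrow> foldr mpoly_deriv js (f $ i) = 0"
    by simp
  \<comment> \<open>The trivial \<open>of_nat 1\<close>, \<open>+ 0\<close> and appended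
    \<open>[]\<close> keep the shape of \<open>shifted_term_bound\<close> with
    \<open>k = 0\<close>.\<close>
  have "matrix_inv (jacobian_mat f x) *v map_eval f (x + v)
      - (matrix_inv (jacobian_mat f x) *v map_eval f x + v)
    = (\<Sum>l<d. of_nat 1 *s taylor_term f x (Suc (Suc l) + 0) (replicate (Suc (Suc l)) v @ []))"
    using taylor_term_shift[OF d2, of "[]" 0 x v]
    by (simp add: higher_deriv_0 sum.lessThan_Suc_shift taylor_term_0 taylor_term_1[OF inv]
        del: sum.lessThan_Suc)
  moreover have "vnorm (\<dots>) \<le> G * (vnorm v)\<^sup>2"
  proof (rule vnorm_sum_le)
    fix l
    have "vnorm (of_nat 1 *s taylor_term f x (Suc (Suc l) + 0) (replicate (Suc (Suc l)) v @ []))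
        \<le> (G * (vnorm v)\<^sup>2) * (G * vnorm v) ^ l"
      using shifted_term_bound[of "Suc (Suc l)" 0 "[]" 1]
      by (simp add: power_mult_distrib power2_eq_square mult_ac)
    also have "\<dots> \<le> G * (vnorm v)\<^sup>2"
      using small_power bound_nonneg by (intro mult_left_le) auto
    finally show "vnorm (of_nat 1 *s taylor_term f x (Suc (Suc l) + 0)
      (replicate (Suc (Suc l)) v @ [])) \<le> G * (vnorm v)\<^sup>2" .
  qed (use bound_nonneg in auto)
  ultimately show ?thesis by simp
qed

text \<open>In the expansion of the derivative the term without \<open>v\<close> is \<open>u\<close>
  itself; every other one has at least one slot filled with \<open>v\<close>.\<close>

lemma jacobian_perturbation:
  "vnorm (matrix_inv (jacobian_mat f x) *v (jacobian_mat f (x + v) *v u) - u)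
    \<le> G * vnorm v * vnorm u"
proof -
  obtain d where d: "\<forall>i js. length js \<ge> d \<longrightarrow> foldr mpoly_deriv js (f $ i) = 0"
    using foldr_mpoly_deriv_eventually_0[of f] by blast
  then have d1: "\<forall>i js. length js \<ge> Suc d \<longrightarrow> foldr mpoly_deriv js (f $ i) = 0"
    by simp
  let ?t = "\<lambda>l. of_nat ((Suc l + Suc 0) choose Suc 0) *s
      taylor_term f x (Suc l + Suc 0) (replicate (Suc l) v @ [u])"
  have "matrix_inv (jacobian_mat f x) *v (jacobian_mat f (x + v) *v u) - u = (\<Sum>l<d. ?t l)"
    using taylor_term_shift[OF d1, of "[u]" "Suc 0" x v]
    by (simp add: higher_deriv_1 sum.lessThan_Suc_shift taylor_term_1[OF inv]
        del: sum.lessThan_Suc binomial_1 choose_one binomial_Suc_Suc)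
  moreover have "vnorm (\<Sum>l<d. ?t l) \<le> G * vnorm v * vnorm u"
  proof (rule vnorm_sum_le)
    fix l
    have "vnorm (?t l) \<le> (G * vnorm v * vnorm u) * (G * vnorm v) ^ l"
      using shifted_term_bound[of "Suc l" "Suc 0" "[u]"]
      by (simp add: power_mult_distrib mult_ac del: binomial_1 choose_one binomial_Suc_Suc)
    also have "\<dots> \<le> G * vnorm v * vnorm u"
      using small_power bound_nonneg by (intro mult_left_le) auto
    finally show "vnorm (?t l) \<le> G * vnorm v * vnorm u" .
  qed (use bound_nonneg in auto)
  ultimately show ?thesis by simp
qed

text \<open>For nonzero \<open>u\<close> the deviation from \<open>u\<close> is strictly shorter
  than \<open>u\<close>, so the isosceles principle applies.\<close>

lemma jacobian_isometry:
  "vnorm (matrix_inv (jacobian_mat f x) *v (jacobian_mat f (x + v) *v u)) = vnorm u"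
proof (cases "u = 0")
  case False
  then have "G * vnorm v * vnorm u < vnorm u"
    using small by (simp add: vnorm_pos_iff)
  with jacobian_perturbation[of u]
  have "vnorm (matrix_inv (jacobian_mat f x) *v (jacobian_mat f (x + v) *v u) - u) < vnorm u"
    by linarith
  from vnorm_add_eq[OF this] show ?thesis by simp
qed simp

text \<open>The isometry leaves no kernel, which suffices for a square matrix.\<close>

lemma invertible_jacobian_perturbed: "invertible (jacobian_mat f (x + v))"
proof -
  have "u = 0" if "jacobian_mat f (x + v) *v u = 0" for u
    using jacobian_isometry[of u] that by simp
  then show ?thesis
    by (auto simp: invertible_left_inverse matrix_left_invertible_ker)
qed

text \<open>The isometry, taken at \<open>matrix_inv (jacobian_mat f (x + v)) *v w\<close>. It lets
  the two inverse Jacobians be exchanged inside a norm.\<close>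

lemma vnorm_matrix_inv_perturbed:
  "vnorm (matrix_inv (jacobian_mat f (x + v)) *v w) = vnorm (matrix_inv (jacobian_mat f x) *v w)"
  using jacobian_isometry[of "matrix_inv (jacobian_mat f (x + v)) *v w"]
  by (simp add: matrix_inv_vector_cancel invertible_jacobian_perturbed)

text \<open>After exchanging the inverse Jacobians, each re-expanded term is at most the required
  bound times \<open>(G * vnorm v) ^ l\<close>. The same \<open>G\<close> survives, which makes
  \<gamma> nonincreasing along the iteration.\<close>

lemma gamma_bound_perturbed: "gamma_bound f (x + v) G"
  unfolding gamma_bound_def
proof (intro conjI allI impI bound_nonneg)
  fix k :: nat and us :: "('a ^ 'n) list"
  assume k: "2 \<le> k" and us: "length us = k"
  obtain d where d: "\<forall>i js. length js \<ge> d \<longrightarrow> foldr mpoly_deriv js (f $ i) = 0"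
    using foldr_mpoly_deriv_eventually_0[of f] by blast
  have "vnorm (taylor_term f (x + v) k us)
      = vnorm (matrix_inv (jacobian_mat f x) *v ((1 / fact k) *s higher_deriv k f (x + v) us))"
    by (simp add: taylor_term_def vnorm_matrix_inv_perturbed)
  also have "\<dots> \<le> G ^ (k - 1) * prod_list (map vnorm us)"
    unfolding taylor_term_shift[OF d us]
  proof (rule vnorm_sum_le)
    fix l
    have "l + k - 1 = (k - 1) + l" using k by simp
    then have "G ^ (l + k - 1) * vnorm v ^ l * prod_list (map vnorm us)
        = (G ^ (k - 1) * prod_list (map vnorm us)) * (G * vnorm v) ^ l"
      by (simp only: power_mult_distrib power_add mult_ac)
    moreover have "vnorm (of_nat ((l + k) choose k) *s
          taylor_term f x (l + k) (replicate l v @ us))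
        \<le> G ^ (l + k - 1) * vnorm v ^ l * prod_list (map vnorm us)"
      using k us by (intro shifted_term_bound) auto
    ultimately have "vnorm (of_nat ((l + k) choose k) *s
          taylor_term f x (l + k) (replicate l v @ us))
        \<le> (G ^ (k - 1) * prod_list (map vnorm us)) * (G * vnorm v) ^ l"
      by (simp only:)
    also have "\<dots> \<le> G ^ (k - 1) * prod_list (map vnorm us)"
      using small_power bound_nonneg by (intro mult_left_le) auto
    finally show "vnorm (of_nat ((l + k) choose k) *s
        taylor_term f x (l + k) (replicate l v @ us)) \<le> G ^ (k - 1) * prod_list (map vnorm us)" .
  qed (use bound_nonneg in auto)
  finally show "vnorm (taylor_term f (x + v) k us) \<le> G ^ (k - 1) * prod_list (map vnorm us)" .
qed

end

subsection \<open>Newton iteration\<close>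

text \<open>Taken with the sign that \<open>newton\<close> subtracts; where the Jacobian is
  invertible its norm is \<beta>.\<close>

definition newton_correction ::
    "('n::finite, 'a::ultrametric_field) mpoly ^ 'n \<Rightarrow> 'a ^ 'n \<Rightarrow> 'a ^ 'n" where
  "newton_correction f x = matrix_inv (jacobian_mat f x) *v map_eval f x"

lemma newton_eq: "newton f x = x + - newton_correction f x"
  by (simp add: newton_def newton_correction_def)

text \<open>The displacement \<open>- newton_correction f x\<close> cancels the linear part in
  \<open>newton_residual\<close>; the inverse Jacobian is then moved to the new point.\<close>

lemma newton_step:
  fixes f :: "('n::finite, 'a::ultrametric_field) mpoly ^ 'n"
  assumes "invertible (jacobian_mat f x)" "gamma_bound f x G"
    "G * vnorm (newton_correction f x) < 1"
  shows "invertible (jacobian_mat f (newton f x))" "gamma_bound f (newton f x) G"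
    "vnorm (newton_correction f (newton f x)) \<le> G * (vnorm (newton_correction f x))\<^sup>2"
proof -
  have small: "G * vnorm (- newton_correction f x) < 1" using assms by simp
  show "invertible (jacobian_mat f (newton f x))" "gamma_bound f (newton f x) G"
    unfolding newton_eq using assms(1,2) small
    by (rule invertible_jacobian_perturbed gamma_bound_perturbed)+
  show "vnorm (newton_correction f (newton f x)) \<le> G * (vnorm (newton_correction f x))\<^sup>2"
    using newton_residual[OF assms(1,2) small]
      vnorm_matrix_inv_perturbed[OF assms(1,2) small, of "map_eval f (newton f x)"]
    by (simp add: newton_eq newton_correction_def)
qed

text \<open>At a zero \<open>z\<close> the residual estimate bounds the sum of the correction and
  \<open>z - x\<close> by \<open>G * (vnorm (z - x))\<^sup>2\<close>, which smallness bounds by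
  \<open>vnorm (z - x)\<close>.\<close>

lemma newton_correction_zero_le:
  assumes "invertible (jacobian_mat f x)" "gamma_bound f x G"
    "G * vnorm (z - x) < 1" "map_eval f z = 0"
  shows "vnorm (newton_correction f x) \<le> vnorm (z - x)"
proof -
  have "G * (vnorm (z - x))\<^sup>2 \<le> vnorm (z - x)"
    using assms(3) mult_right_mono[of "G * vnorm (z - x)" 1 "vnorm (z - x)"]
    by (simp add: power2_eq_square mult.assoc)
  then have "vnorm (- (newton_correction f x + (z - x))) \<le> vnorm (z - x)"
    using newton_residual[OF assms(1-3)] assms(4) by (simp add: newton_correction_def)
  from vnorm_diff_le[OF this[unfolded vnorm_minus], of "z - x"] show ?thesis by simp
qed

section \<open>Limit of the Newton sequence\<close>

text \<open>Completeness of the field acts coordinatewise; the sum of the coordinate distances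
  dominates the maximum norm and tends to 0.\<close>

lemma vec_ultrametric_Cauchy_converges:
  fixes X :: "nat \<Rightarrow> 'a::{ultrametric_field, complete_space} ^ 'n"
  assumes "\<And>k m. m \<ge> k \<Longrightarrow> vnorm (X m - X k) \<le> b k" "b \<longlonglongrightarrow> 0"
  obtains L where "(\<lambda>k. vnorm (X k - L)) \<longlonglongrightarrow> 0"
proof -
  have dist_le: "dist (X m $ i) (X k $ i) \<le> vnorm (X m - X k)" for m k i
    using vnorm_ge_absval[of "X m - X k" i] by (simp add: dist_absval)
  have "Cauchy (\<lambda>k. X k $ i)" for i
  proof (rule metric_CauchyI)
    fix e :: real assume "e > 0"
    then obtain N where N: "b N < e"
      using order_tendstoD(2)[OF assms(2), of e] by (auto simp: eventually_sequentially)
    have "absval ((X m - X N) $ i) < e" if "m \<ge> N" for m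
      using assms(1)[OF that] N vnorm_ge_absval[of "X m - X N" i] by linarith
    \<comment> \<open>Comparing both indices with \<open>N\<close> costs no factor 2 in an
      ultrametric.\<close>
    moreover have "absval (X m $ i - X n $ i)
        \<le> max (absval ((X m - X N) $ i)) (absval ((X n - X N) $ i))" for m n
      using absval_ultrametric[of "(X m - X N) $ i" "- ((X n - X N) $ i)"]
      by (simp only: absval_minus) simp
    ultimately show "\<exists>M. \<forall>m\<ge>M. \<forall>n\<ge>M. dist (X m $ i) (X n $ i) < e"
      unfolding dist_absval by (meson le_less_trans max_less_iff_conj)
  qed
  then have "\<exists>L. (\<lambda>k. X k $ i) \<longlonglongrightarrow> L" for i
    using Cauchy_convergent convergent_def by blast
  then obtain L where L: "\<And>i. (\<lambda>k. X k $ i) \<longlonglongrightarrow> L i" by metis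
  have "(\<lambda>k. \<Sum>i\<in>UNIV. dist (X k $ i) (L i)) \<longlonglongrightarrow> (\<Sum>i\<in>(UNIV :: 'n set). 0)"
    by (intro tendsto_sum L[THEN tendsto_dist_iff[THEN iffD1]])
  then have lim: "(\<lambda>k. \<Sum>i\<in>UNIV. dist (X k $ i) (L i)) \<longlonglongrightarrow> 0" by simp
  have "vnorm (X k - vec_lambda L) \<le> (\<Sum>i\<in>UNIV. dist (X k $ i) (L i))" for k
    by (auto simp: vnorm_le_iff simp flip: dist_absval
        intro!: member_le_sum[of _ UNIV "\<lambda>i. dist (X k $ i) (L i)"])
  then have "(\<lambda>k. vnorm (X k - vec_lambda L)) \<longlonglongrightarrow> 0"
    by (intro tendsto_sandwich[OF _ _ tendsto_const lim]) auto
  then show ?thesis by (rule that)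
qed

context
  fixes f :: "('n::finite, 'a::{ultrametric_field, complete_space}) mpoly ^ 'n"
    and x :: "'a ^ 'n" and G :: real
  assumes inv: "invertible (jacobian_mat f x)"
    and bound: "gamma_bound f x G"
    and small: "G * vnorm (newton_correction f x) < 1"
begin

abbreviation (input) iter :: "nat \<Rightarrow> 'a ^ 'n" where
  "iter k \<equiv> (newton f ^^ k) x"

abbreviation (input) corr :: "nat \<Rightarrow> real" where
  "corr k \<equiv> vnorm (newton_correction f (iter k))"

lemma iter_bound_nonneg: "G \<ge> 0"
  using bound by (simp add: gamma_bound_def)

lemma rate_nonneg: "G * corr 0 \<ge> 0"
  using iter_bound_nonneg by simp

text \<open>Squaring doubles the exponent and the factor \<open>G * corr 0\<close> adds one, in
  accordance with \<open>2 ^ Suc k - 1 = 2 * (2 ^ k - 1) + 1\<close>. The bound also keeps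
  \<open>corr k \<le> corr 0\<close>, so \<open>newton_step\<close> stays applicable.\<close>

lemma iter_invariant:
  "invertible (jacobian_mat f (iter k)) \<and> gamma_bound f (iter k) G \<and>
    corr k \<le> (G * corr 0) ^ (2 ^ k - 1) * corr 0"
proof (induction k)
  case 0
  show ?case using inv bound by simp
next
  case (Suc k)
  let ?c = "G * corr 0"
  have "?c ^ (2 ^ k - 1) * corr 0 \<le> corr 0"
    using small rate_nonneg by (intro mult_left_le_one_le power_le_one zero_le_power) auto
  with Suc.IH have "corr k \<le> corr 0" by linarith
  then have "G * corr k \<le> G * corr 0"
    using iter_bound_nonneg by (rule mult_left_mono)
  with small have "G * corr k < 1" by simp
  note step = newton_step[OF _ _ this]
  have "2 ^ Suc k - 1 = Suc ((2 ^ k - 1) + (2 ^ k - 1 :: nat))"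
    using one_le_power[of "2::nat" k] by (simp only: power_Suc) linarith
  then have e: "?c ^ (2 ^ Suc k - 1) = ?c * (?c ^ (2 ^ k - 1) * ?c ^ (2 ^ k - 1))"
    by (simp only: power_Suc power_add)
  have "corr (Suc k) \<le> G * (corr k)\<^sup>2"
    using step Suc.IH by simp
  also have "\<dots> \<le> G * (?c ^ (2 ^ k - 1) * corr 0)\<^sup>2"
    using Suc.IH iter_bound_nonneg by (intro mult_left_mono power_mono) auto
  also have "\<dots> = ?c ^ (2 ^ Suc k - 1) * corr 0"
    unfolding e by (simp only: power2_eq_square mult_ac)
  finally show ?case using step Suc.IH by simp
qed

lemma corr_le_initial: "corr k \<le> corr 0"
proof -
  have "(G * corr 0) ^ (2 ^ k - 1) * corr 0 \<le> corr 0"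
    using small rate_nonneg by (intro mult_left_le_one_le power_le_one zero_le_power) auto
  with iter_invariant[of k] show ?thesis by linarith
qed

lemma small_corr: "G * corr k < 1"
  using mult_left_mono[OF corr_le_initial iter_bound_nonneg, of k] small by simp

lemma corr_Suc: "corr (Suc k) \<le> G * (corr k)\<^sup>2"
  using newton_step(3)[OF _ _ small_corr] iter_invariant[of k] by simp

text \<open>The quadratic bound contracts strictly because \<open>G * corr k < 1\<close>. Strictness
  is what makes a step dominate all later ones.\<close>

lemma corr_Suc_less: "corr k \<noteq> 0 \<Longrightarrow> corr (Suc k) < corr k"
proof -
  assume "corr k \<noteq> 0"
  then have "corr k > 0" using vnorm_nonneg[of "newton_correction f (iter k)"] by linarith
  then have "G * corr k * corr k < 1 * corr k"
    using small_corr[of k] by (intro mult_strict_right_mono)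
  with corr_Suc[of k] show ?thesis by (simp add: power2_eq_square mult.assoc)
qed

lemma corr_decreasing: "m \<ge> k \<Longrightarrow> corr m \<le> corr k"
proof (rule lift_Suc_antimono_le[of corr])
  show "corr (Suc j) \<le> corr j" for j
    using corr_Suc_less[of j] corr_Suc[of j] by (cases "corr j = 0") auto
qed

text \<open>A geometric bound suffices, as \<open>2 ^ k - 1 \<ge> k\<close>.\<close>

lemma corr_tendsto_0: "corr \<longlonglongrightarrow> 0"
proof -
  let ?c = "G * corr 0"
  have "corr k \<le> ?c ^ k * corr 0" for k
  proof -
    have "k \<le> 2 ^ k - (1::nat)" using less_exp[of k] by linarith
    then have "?c ^ (2 ^ k - 1) \<le> ?c ^ k"
      using small rate_nonneg by (intro power_decreasing) auto
    then have "?c ^ (2 ^ k - 1) * corr 0 \<le> ?c ^ k * corr 0"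
      by (intro mult_right_mono) auto
    with iter_invariant[of k] show ?thesis by linarith
  qed
  then have le: "\<forall>\<^sub>F k in sequentially. corr k \<le> ?c ^ k * corr 0"
    by (intro always_eventually allI)
  have lim: "(\<lambda>k. ?c ^ k * corr 0) \<longlonglongrightarrow> 0"
    using small rate_nonneg by (intro tendsto_mult_left_zero LIMSEQ_realpow_zero) auto
  show ?thesis
    by (rule tendsto_sandwich[OF _ le tendsto_const lim]) simp
qed

text \<open>Telescoping with decreasing steps: the ultrametric inequality bounds the sum by its
  first step rather than by a series.\<close>

lemma iter_diff_le: "m \<ge> k \<Longrightarrow> vnorm (iter m - iter k) \<le> corr k"
proof (induction m rule: dec_induct)
  case (step m)
  have "iter (Suc m) - iter k = (iter m - iter k) - newton_correction f (iter m)"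
    by (simp add: newton_eq)
  then show ?case
    unfolding \<open>iter (Suc m) - iter k = _\<close>
    using vnorm_diff_le[OF step.IH corr_decreasing[of k m]] step.hyps by simp
qed simp

lemma newton_limit:
  obtains \<zeta> where "map_eval f \<zeta> = 0" "invertible (jacobian_mat f \<zeta>)"
    "\<And>k. vnorm (iter k - \<zeta>) = corr k"
proof -
  obtain \<zeta> where lim: "(\<lambda>k. vnorm (iter k - \<zeta>)) \<longlonglongrightarrow> 0"
    using vec_ultrametric_Cauchy_converges[OF iter_diff_le corr_tendsto_0] by metis
  have le: "vnorm (iter k - \<zeta>) \<le> corr k" for k
  proof (rule field_le_epsilon)
    fix e :: real assume "e > 0"
    then have "\<forall>\<^sub>F m in sequentially. vnorm (iter m - \<zeta>) < e"
      using order_tendstoD(2)[OF lim] by blast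
    then obtain m where m: "m \<ge> k" "vnorm (iter m - \<zeta>) < e"
      unfolding eventually_sequentially by (meson nle_le)
    have "corr k \<ge> 0" by simp
    then have "vnorm ((iter m - \<zeta>) - (iter m - iter k)) \<le> corr k + e"
      using m(2) iter_diff_le[OF m(1)] \<open>e > 0\<close> by (intro vnorm_diff_le[of "iter m - \<zeta>"]) linarith+
    then show "vnorm (iter k - \<zeta>) \<le> corr k + e" by simp
  qed
  \<comment> \<open>The step from \<open>iter k\<close> is strictly longer than the remaining
    distance to the limit, hence as long as the whole distance.\<close>
  have eq: "vnorm (iter k - \<zeta>) = corr k" for k
  proof (cases "corr k = 0")
    case True
    then show ?thesis using le[of k] vnorm_nonneg[of "iter k - \<zeta>"] by linarith
  next
    case False
    have "iter k - \<zeta> = newton_correction f (iter k) + (iter (Suc k) - \<zeta>)"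
      by (simp add: newton_eq)
    moreover have "vnorm (iter (Suc k) - \<zeta>) < corr k"
      using le[of "Suc k"] corr_Suc_less[OF False] by linarith
    ultimately show ?thesis by (simp only: vnorm_add_eq)
  qed
  have small': "G * vnorm (\<zeta> - iter k) < 1" for k
    using small_corr[of k] by (simp add: eq vnorm_minus_commute[of \<zeta>])
  \<comment> \<open>The displacement from \<open>x\<close> to the limit has length
    \<open>corr 0\<close>, inside the perturbation radius.\<close>
  have inv': "invertible (jacobian_mat f \<zeta>)"
    using invertible_jacobian_perturbed[OF inv bound, of "\<zeta> - x"] small'[of 0] by simp
  \<comment> \<open>The limit is recognised as a zero by the Taylor residual at
    \<open>iter k\<close>: both linear terms have norm \<open>corr k\<close>, and exchanging inverse
    Jacobians gives a left side independent of \<open>k\<close>.\<close>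
  have "vnorm (matrix_inv (jacobian_mat f \<zeta>) *v map_eval f \<zeta>) \<le> corr k" for k
  proof -
    note step = iter_invariant[of k, THEN conjunct1]
      iter_invariant[of k, THEN conjunct2, THEN conjunct1] small'[of k]
    let ?r = "matrix_inv (jacobian_mat f (iter k)) *v map_eval f \<zeta>"
    let ?s = "newton_correction f (iter k) + (\<zeta> - iter k)"
    have dist: "vnorm (\<zeta> - iter k) = corr k"
      by (simp add: eq vnorm_minus_commute[of \<zeta>])
    have "vnorm (?r - ?s) \<le> G * (corr k)\<^sup>2"
      using newton_residual[OF step] by (simp add: newton_correction_def dist)
    also have "\<dots> \<le> corr k"
      using small_corr[of k] mult_right_mono[of "G * corr k" 1 "corr k"]
      by (simp add: power2_eq_square mult.assoc)
    finally have "vnorm ((?r - ?s) + ?s) \<le> corr k"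
      by (intro vnorm_add_le) (auto simp: dist)
    then show ?thesis
      using vnorm_matrix_inv_perturbed[OF step, of "map_eval f \<zeta>"] by simp
  qed
  then have "vnorm (matrix_inv (jacobian_mat f \<zeta>) *v map_eval f \<zeta>) \<le> 0"
    using LIMSEQ_le_const[OF corr_tendsto_0] by blast
  then have "matrix_inv (jacobian_mat f \<zeta>) *v map_eval f \<zeta> = 0"
    using vnorm_nonneg vnorm_eq_0_iff order_antisym by metis
  then have "map_eval f \<zeta> = 0"
    using matrix_inv_vector_cancel(2)[OF inv', of "map_eval f \<zeta>"] by simp
  with inv' eq that show ?thesis by blast
qed

end

subsection \<open>The real-valued invariants\<close>

text \<open>For \<open>G = 0\<close> the quotient is infinite and both sides hold; otherwise it is a
  real quotient.\<close>

lemma ennreal_less_inverse_iff: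
  assumes "G \<ge> 0" "v \<ge> 0"
  shows "ennreal v < 1 / ennreal G \<longleftrightarrow> G * v < 1"
proof (cases "G = 0")
  case False
  with assms have "1 / ennreal G = ennreal (1 / G)"
    using divide_ennreal[of 1 G] by simp
  then show ?thesis
    using False assms by (simp add: ennreal_less_iff pos_less_divide_eq mult.commute)
qed (simp add: ennreal_divide_eq_top_iff)

context
  fixes f :: "('n::finite, 'a::ultrametric_field) mpoly ^ 'n" and x :: "'a ^ 'n"
  assumes inv: "invertible (jacobian_mat f x)"
begin

lemma smale_gamma_eq: "smale_gamma f x = ennreal (enn2real (smale_gamma f x))"
  using smale_gamma_less_top[OF inv] by simp

lemma smale_beta_eq: "smale_beta f x = ennreal (vnorm (newton_correction f x))"
  using inv by (simp add: smale_beta_def newton_correction_def)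

lemma smale_alpha_eq:
  "smale_alpha f x
    = ennreal (enn2real (smale_gamma f x) * vnorm (newton_correction f x))"
  unfolding smale_alpha_def smale_beta_eq
  by (subst smale_gamma_eq) (simp add: ennreal_mult mult.commute)

lemma smale_alpha_less_1_iff:
  "smale_alpha f x < 1 \<longleftrightarrow> enn2real (smale_gamma f x) * vnorm (newton_correction f x) < 1"
  unfolding smale_alpha_eq by (simp add: ennreal_less_one_iff)

end

section \<open>The equivalence and the convergence estimates\<close>

lemma invertible_if_smale_alpha_less_1:
  assumes "smale_alpha f x < 1"
  shows "invertible (jacobian_mat f x)"
proof (rule ccontr)
  assume "\<not> invertible (jacobian_mat f x)"
  then have "smale_alpha f x = \<infinity>"
    by (simp add: smale_alpha_def smale_beta_def smale_gamma_def ennreal_mult_eq_top_iff)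
  with assms show False by simp
qed

text \<open>A strict upper bound on the infimum provides an actual zero closer than 1/\<gamma>, and
  its distance bounds \<beta>.\<close>

lemma smale_alpha_less_1_if_close_zero:
  fixes f :: "('n::finite, 'a::ultrametric_field) mpoly ^ 'n"
  assumes "dist_to_zeros f x < 1 / smale_gamma f x"
  shows "smale_alpha f x < 1"
proof -
  have inv: "invertible (jacobian_mat f x)"
    \<comment> \<open>In the singular case \<gamma> is infinite, so the right-hand side is
      0.\<close>
    using assms by (rule contrapos_pp) (simp add: smale_gamma_def)
  let ?G = "enn2real (smale_gamma f x)"
  obtain z where z: "map_eval f z = 0" "ennreal (vnorm (x - z)) < 1 / ennreal ?G"
    using assms unfolding dist_to_zeros_def INF_less_iff smale_gamma_eq[OF inv, symmetric] by blast
  then have small: "?G * vnorm (z - x) < 1"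
    by (simp add: ennreal_less_inverse_iff vnorm_minus_commute[of z])
  have "?G * vnorm (newton_correction f x) \<le> ?G * vnorm (z - x)"
    using newton_correction_zero_le[OF inv gamma_bound_smale_gamma[OF inv] small z(1)]
    by (intro mult_left_mono) auto
  with small show ?thesis
    by (simp add: smale_alpha_less_1_iff[OF inv])
qed

text \<open>The Newton limit is itself a zero at distance \<beta> from \<open>x\<close>, and
  \<alpha> < 1 amounts to \<beta> < 1/\<gamma>. The remaining claims transfer the real estimates to
  \<open>ennreal\<close>.\<close>

lemma newton_converges_if_smale_alpha_less_1:
  fixes f :: "('n::finite, 'a::{ultrametric_field, complete_space}) mpoly ^ 'n"
    and x :: "'a ^ 'n"
  assumes alpha: "smale_alpha f x < 1"
  shows "dist_to_zeros f x < 1 / smale_gamma f x"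
    and "\<forall>k. invertible (jacobian_mat f ((newton f ^^ k) x))"
    and "\<exists>\<zeta>. map_eval f \<zeta> = 0 \<and> invertible (jacobian_mat f \<zeta>) \<and>
        converges_quadratically (\<lambda>k. (newton f ^^ k) x) \<zeta> \<and>
        (\<forall>k. smale_alpha f ((newton f ^^ k) x) \<le> smale_alpha f x ^ (2 ^ k) \<and>
             smale_beta f ((newton f ^^ k) x) \<le> smale_alpha f x ^ (2 ^ k - 1) * smale_beta f x \<and>
             smale_gamma f ((newton f ^^ k) x) \<le> smale_gamma f x \<and>
             ennreal (vnorm ((newton f ^^ k) x - \<zeta>)) = smale_beta f ((newton f ^^ k) x) \<and>
             (smale_alpha f x \<noteq> 0 \<or> k = 0 \<longrightarrow>
                smale_alpha f x ^ (2 ^ k - 1) * smale_beta f x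
                  < smale_alpha f x ^ (2 ^ k - 1) / smale_gamma f x))"
proof -
  let ?X = "\<lambda>k. (newton f ^^ k) x"
  define G where "G = enn2real (smale_gamma f x)"
  define b where "b = (\<lambda>k. vnorm (newton_correction f (?X k)))"
  have inv: "invertible (jacobian_mat f x)"
    using alpha by (rule invertible_if_smale_alpha_less_1)
  have G: "G \<ge> 0" "smale_gamma f x = ennreal G"
    using smale_gamma_eq[OF inv] by (auto simp: G_def)
  have b: "b k \<ge> 0" for k by (simp add: b_def)
  have beta: "smale_beta f x = ennreal (b 0)"
    using smale_beta_eq[OF inv] by (simp add: b_def)
  have alpha_eq: "smale_alpha f x = ennreal (G * b 0)"
    using smale_alpha_eq[OF inv] by (simp add: b_def G_def)
  have alpha_pow: "smale_alpha f x ^ n = ennreal ((G * b 0) ^ n)" for n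
    using G b by (simp add: alpha_eq ennreal_power)
  have small: "G * vnorm (newton_correction f x) < 1"
    using alpha smale_alpha_less_1_iff[OF inv] by (simp add: G_def)
  then have small0: "G * b 0 < 1" by (simp add: b_def)
  note iterate = inv gamma_bound_smale_gamma[OF inv, folded G_def] small
  have invX: "invertible (jacobian_mat f (?X k))"
    and boundX: "gamma_bound f (?X k) G"
    and bX: "b k \<le> (G * b 0) ^ (2 ^ k - 1) * b 0" for k
    using iter_invariant[OF iterate, of k] by (auto simp: b_def)
  have betaX: "smale_beta f (?X k) = ennreal (b k)" for k
    by (simp add: smale_beta_eq[OF invX] b_def)
  show "\<forall>k. invertible (jacobian_mat f (?X k))" using invX by blast
  obtain \<zeta> where z: "map_eval f \<zeta> = 0" "invertible (jacobian_mat f \<zeta>)"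
    "\<And>k. vnorm (?X k - \<zeta>) = b k"
    using newton_limit[OF iterate] unfolding b_def by blast
  have beta_less: "smale_beta f x < 1 / smale_gamma f x"
    using small0 G b by (simp add: beta ennreal_less_inverse_iff)
  have "dist_to_zeros f x \<le> ennreal (vnorm (x - \<zeta>))"
    unfolding dist_to_zeros_def using z(1) by (intro INF_lower) auto
  also have "\<dots> = smale_beta f x" using z(3)[of 0] beta by simp
  also note beta_less
  finally show "dist_to_zeros f x < 1 / smale_gamma f x" .
  have "converges_quadratically ?X \<zeta>"
    unfolding converges_quadratically_def z(3)
  proof (intro conjI exI allI)
    show "b \<longlonglongrightarrow> 0" using corr_tendsto_0[OF iterate] by (simp add: b_def)
    show "b (Suc k) \<le> G * (b k)\<^sup>2" for k
      using corr_Suc[OF iterate, of k] by (simp only: b_def)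
  qed
  moreover have "smale_alpha f (?X k) \<le> smale_alpha f x ^ (2 ^ k)" for k
  proof -
    have "smale_alpha f (?X k) \<le> ennreal (b k) * ennreal G"
      unfolding smale_alpha_def betaX
      by (intro mult_left_mono smale_gamma_le invX boundX) simp
    also have "\<dots> = ennreal (G * b k)"
      using G b by (simp add: ennreal_mult mult.commute)
    \<comment> \<open>The extra factor \<open>G\<close> turns the exponent \<open>2 ^ k - 1\<close>
      of the step estimate into \<open>2 ^ k\<close>.\<close>
    also have "G * b k \<le> G * ((G * b 0) ^ (2 ^ k - 1) * b 0)"
      using bX G by (intro mult_left_mono)
    also have "\<dots> = (G * b 0) ^ Suc (2 ^ k - 1)" by (simp only: power_Suc mult_ac)
    also have "Suc (2 ^ k - 1) = (2::nat) ^ k" by simp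
    finally show ?thesis by (simp add: alpha_pow ennreal_leI)
  qed
  moreover have "smale_beta f (?X k) \<le> smale_alpha f x ^ (2 ^ k - 1) * smale_beta f x" for k
    unfolding betaX alpha_pow beta
    using bX[of k] G b by (simp add: ennreal_leI flip: ennreal_mult)
  moreover have "smale_gamma f (?X k) \<le> smale_gamma f x" for k
    unfolding G by (intro smale_gamma_le invX boundX)
  moreover have "ennreal (vnorm (?X k - \<zeta>)) = smale_beta f (?X k)" for k
    by (simp add: betaX z(3))
  moreover have "smale_alpha f x ^ (2 ^ k - 1) * smale_beta f x
      < smale_alpha f x ^ (2 ^ k - 1) / smale_gamma f x" if "smale_alpha f x \<noteq> 0 \<or> k = 0" for k
  proof (cases "k = 0")
    \<comment> \<open>Here \<alpha> is nonzero, so \<open>G\<close> and the power are positive and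
      the division is real. At \<open>k = 0\<close> the claim is \<beta> < 1/\<gamma>, where
      \<gamma> may be 0.\<close>
    case False
    with that have "G * b 0 > 0" by (simp add: alpha_eq ennreal_eq_0_iff)
    then have pos: "(G * b 0) ^ (2 ^ k - 1) > 0" "G > 0"
      using G(1) b[of 0] by (auto simp: zero_less_mult_iff)
    then have "b 0 < 1 / G" using small0 by (simp add: pos_less_divide_eq mult.commute)
    then have "(G * b 0) ^ (2 ^ k - 1) * b 0 < (G * b 0) ^ (2 ^ k - 1) / G"
      using mult_strict_left_mono[OF _ pos(1), of "b 0" "1 / G"] by simp
    then show ?thesis
      unfolding alpha_pow beta G(2) using pos b
      by (simp add: divide_ennreal ennreal_less_iff flip: ennreal_mult)
  qed (use beta_less in simp)
  ultimately show "\<exists>\<zeta>. map_eval f \<zeta> = 0 \<and> invertible (jacobian_mat f \<zeta>) \<and>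
        converges_quadratically ?X \<zeta> \<and>
        (\<forall>k. smale_alpha f (?X k) \<le> smale_alpha f x ^ (2 ^ k) \<and>
             smale_beta f (?X k) \<le> smale_alpha f x ^ (2 ^ k - 1) * smale_beta f x \<and>
             smale_gamma f (?X k) \<le> smale_gamma f x \<and>
             ennreal (vnorm (?X k - \<zeta>)) = smale_beta f (?X k) \<and>
             (smale_alpha f x \<noteq> 0 \<or> k = 0 \<longrightarrow>
                smale_alpha f x ^ (2 ^ k - 1) * smale_beta f x
                  < smale_alpha f x ^ (2 ^ k - 1) / smale_gamma f x))"
    using z(1,2) by (intro exI[of _ \<zeta>]) simp
qed

text \<open>The bounds on \<beta> have the exponent \<open>2 ^ k - 1\<close>: at
  \<open>k = 0\<close> the exponent \<open>2 ^ k\<close> would claim \<beta> \<le> \<alpha> \<beta>,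
  which fails for \<beta> > 0. The strict inequality is conditional because for \<alpha> = 0 and
  \<open>k > 0\<close> both sides are 0.\<close>

theorem theoremA2:
  fixes f :: "('n::finite, 'a::{ultrametric_field, complete_space}) mpoly ^ 'n"
    and x :: "'a ^ 'n"
  shows "(smale_alpha f x < 1 \<longleftrightarrow> dist_to_zeros f x < 1 / smale_gamma f x) \<and>
    (smale_alpha f x < 1 \<or> dist_to_zeros f x < 1 / smale_gamma f x \<longrightarrow>
      (\<forall>k. invertible (jacobian_mat f ((newton f ^^ k) x))) \<and>
      (\<exists>\<zeta>. map_eval f \<zeta> = 0 \<and> invertible (jacobian_mat f \<zeta>) \<and>
        converges_quadratically (\<lambda>k. (newton f ^^ k) x) \<zeta> \<and>
        (\<forall>k. smale_alpha f ((newton f ^^ k) x) \<le> smale_alpha f x ^ (2 ^ k) \<and>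
             smale_beta f ((newton f ^^ k) x) \<le> smale_beta f x * smale_alpha f x ^ (2 ^ k - 1) \<and>
             smale_gamma f ((newton f ^^ k) x) \<le> smale_gamma f x \<and>
             ennreal (vnorm ((newton f ^^ k) x - \<zeta>)) = smale_beta f ((newton f ^^ k) x) \<and>
             smale_beta f ((newton f ^^ k) x) \<le> smale_alpha f x ^ (2 ^ k - 1) * smale_beta f x \<and>
             (smale_alpha f x \<noteq> 0 \<or> k = 0 \<longrightarrow>
                smale_alpha f x ^ (2 ^ k - 1) * smale_beta f x
                  < smale_alpha f x ^ (2 ^ k - 1) / smale_gamma f x))))"
proof -
  have iff: "smale_alpha f x < 1 \<longleftrightarrow> dist_to_zeros f x < 1 / smale_gamma f x"
    using newton_converges_if_smale_alpha_less_1(1) smale_alpha_less_1_if_close_zero by blast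
  show ?thesis
  proof (intro conjI impI iff)
    assume "smale_alpha f x < 1 \<or> dist_to_zeros f x < 1 / smale_gamma f x"
    then have alpha: "smale_alpha f x < 1" using iff by blast
    note newton = newton_converges_if_smale_alpha_less_1[OF alpha]
    show "\<forall>k. invertible (jacobian_mat f ((newton f ^^ k) x))" by (rule newton(2))
    show "\<exists>\<zeta>. map_eval f \<zeta> = 0 \<and> invertible (jacobian_mat f \<zeta>) \<and>
        converges_quadratically (\<lambda>k. (newton f ^^ k) x) \<zeta> \<and>
        (\<forall>k. smale_alpha f ((newton f ^^ k) x) \<le> smale_alpha f x ^ (2 ^ k) \<and>
             smale_beta f ((newton f ^^ k) x) \<le> smale_beta f x * smale_alpha f x ^ (2 ^ k - 1) \<and>
             smale_gamma f ((newton f ^^ k) x) \<le> smale_gamma f x \<and>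
             ennreal (vnorm ((newton f ^^ k) x - \<zeta>)) = smale_beta f ((newton f ^^ k) x) \<and>
             smale_beta f ((newton f ^^ k) x) \<le> smale_alpha f x ^ (2 ^ k - 1) * smale_beta f x \<and>
             (smale_alpha f x \<noteq> 0 \<or> k = 0 \<longrightarrow>
                smale_alpha f x ^ (2 ^ k - 1) * smale_beta f x
                  < smale_alpha f x ^ (2 ^ k - 1) / smale_gamma f x))"
      using newton(3) unfolding mult.commute[of "smale_beta f x"] by blast
  qed
qed

end
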